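(* Let $N\ge 2$ be the vocabulary size, let $\mathcal V=\{v^1,\dots,v^N\}$ be the vocabulary, and let $f=f_L\circ f_{L-1}\circ\cdots\circ f_1$ be a layered model (a large language model, each $f_\ell$ being a layer of the network) with input $a_0$ and activations $a_\ell=f_\ell(a_{\ell-1})$ for $\ell=1,\dots,L$. Its last activation $a_L=(a_L^1,\dots,a_L^N)\in\mathbb R^N$ is the logit vector, defining the token distribution $\pi_\theta(v^n)=e^{a_L^n}/\sum_{m=1}^N e^{a_L^m}$. Assume that for every layer $\ell\in\{1,\dots,L\}$ the Jacobian $J_\ell:=\frac{\partial f_\ell(a_{\ell-1})}{\partial a_{\ell-1}}$ is well defined and $f_\ell$ is locally differentiable, and that for each layer there exist two constants $c_\ell>0$ and $d_\ell>0$ such that $\sigma_{\min}(J_\ell)\ge c_\ell$ and $\sigma_{\max}(J_\ell)\le d_\ell$, where $\sigma_{\min}(\cdot)$ and $\sigma_{\max}(\cdot)$ denote the minimum and maximum singular values of the given matrix. Let $o_{i,t}\in\mathcal V$ be a token, let $J_{GRPO}(o_{i,t})$ be its single-token GRPO objective and $w_{i,t}$ its GRPO weight (both defined in the context), and let $\delta_\ell(o_{i,t}):=\nabla_{a_\ell}J_{GRPO}(o_{i,t})$ be the gradient of the objective with respect to the activation $a_\ell$. Let $\|\cdot\|$ denote the spectral norm. Then for each layer $\ell\in\{1,\dots,L\}$ the following inequalities always hold: $$\prod_{j=\ell+1}^L c_j\cdot |w_{i,t}|\cdot\sqrt{\frac{N}{N-1}}\cdot\bigl(1-\pi_\theta(o_{i,t})\bigr)\;\le\;\|\delta_\ell(o_{i,t})\|\;\le\;\prod_{j=\ell+1}^L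 d_j\cdot |w_{i,t}|\cdot\sqrt{2}\cdot\bigl(1-\pi_\theta(o_{i,t})\bigr).$$
   Context: **Norms.** Activations are real finite-dimensional vectors. The spectral norm of a vector is its Euclidean norm. Empty products equal $1$. **Single-token GRPO objective** (GRPO = Group Relative Policy Optimization, a reinforcement learning algorithm for language models). A prompt and the previously generated tokens are fixed and determine the input $a_0$; $\pi_\theta(o_{i,t})$ is the probability of the token given these. The following are fixed and do not depend on the activations: the probabilities $\pi_{old}(o_{i,t})>0$ and $\pi_{ref}(o_{i,t})>0$ of the token under a sampling policy and a reference policy, the advantage $\hat A_{i,t}\in\mathbb R$, the clipping parameters $\epsilon_l,\epsilon_h>0$, and the KL coefficient $\beta\ge 0$. Put $r=\pi_\theta(o_{i,t})/\pi_{old}(o_{i,t})$. The objective contribution of the token is $$J_{GRPO}(o_{i,t})=\min\bigl[r\,\hat A_{i,t},\ \mathrm{clip}(r;1-\epsilon_l,1+\epsilon_h)\,\hat A_{i,t}\bigr]-\beta\Bigl(\frac{\pi_{ref}(o_{i,t})}{\pi_\theta(o_{i,t})}-\log\frac{\pi_{ref}(o_{i,t})}{\pi_\theta(o_{i,t})}-1\Bigr),$$ where $\mathrm{clip}(x;a,b)=\min(\max(x,a),b)$. It is viewed as a function of $a_\ell$ through $a_L=f_L\circ\cdots\circ f_{\ell+1}(a_\ell)$ and the softmax. **Weight.** $$w_{i,t}=\frac{\pi_\theta(o_{i,t})}{\pi_{old}(o_{i,t})}\hat A_{i,t}\cdot\mathbb I_{\mathrm{trust}}+\beta\frac{\pi_{ref}(o_{i,t})}{\pi_\theta(o_{i,t})}-\beta,$$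 where $\mathbb I_{\mathrm{trust}}=0$ if ($\hat A_{i,t}>0$ and $r>1+\epsilon_h$) or ($\hat A_{i,t}<0$ and $r<1-\epsilon_l$), and $\mathbb I_{\mathrm{trust}}=1$ otherwise. **Gradient.** The gradient of the single-token objective is $\nabla J_{GRPO}(o_{i,t})=w_{i,t}\,\nabla\log\pi_\theta(o_{i,t})$; at the kinks of the clipped term ($r=1+\epsilon_h$ with $\hat A_{i,t}>0$, or $r=1-\epsilon_l$ with $\hat A_{i,t}<0$) this formula is taken as the definition of the gradient.
   Formalization: An m×n Jacobian is given m singular values (square roots of the eigenvalues of J J^T), so σ_min(J) ≥ c > 0 excludes layers with more outputs than inputs; with the usual min(m,n) convention the lower bound fails for such layers. *)

theory Defs
  imports Complex_Main "Jordan_Normal_Form.Char_Poly"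
begin

section \<open>Euclidean norm, Frechet derivatives and singular values\<close>

text \<open>
  The layers of a network have different widths, so activations are vectors of
  \<open>carrier_vec n\<close> with a natural number \<open>n\<close>. This type of vectors
  is not a normed space, hence norm and total derivative are spelled out.
\<close>

definition euclid_norm :: "real Matrix.vec \<Rightarrow> real" where
  "euclid_norm v = sqrt (v \<bullet> v)"

definition has_jacobian ::
  "(real Matrix.vec \<Rightarrow> real Matrix.vec) \<Rightarrow> nat \<Rightarrow> nat \<Rightarrow> real Matrix.vec \<Rightarrow> real mat \<Rightarrow> bool" where
  "has_jacobian f n m a J \<longleftrightarrow>
     a \<in> carrier_vec n \<and> J \<in> carrier_mat m n \<and>
     (\<forall>e>0. \<exists>d>0. \<forall>x\<in>carrier_vec n. euclid_norm (x - a) < d \<longrightarrow>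
        euclid_norm (f x - f a - J *\<^sub>v (x - a)) \<le> e * euclid_norm (x - a))"

text \<open>Total differentiability at the point \<open>a\<close> of a map from dimension \<open>n\<close> to dimension \<open>m\<close>.\<close>

definition differentiable_vec_at ::
  "(real Matrix.vec \<Rightarrow> real Matrix.vec) \<Rightarrow> nat \<Rightarrow> nat \<Rightarrow> real Matrix.vec \<Rightarrow> bool" where
  "differentiable_vec_at f n m a \<longleftrightarrow> (\<exists>J. has_jacobian f n m a J)"

definition jacobian ::
  "(real Matrix.vec \<Rightarrow> real Matrix.vec) \<Rightarrow> nat \<Rightarrow> nat \<Rightarrow> real Matrix.vec \<Rightarrow> real mat" where
  "jacobian f n m a = (THE J. has_jacobian f n m a J)"

definition has_gradient ::
  "(real Matrix.vec \<Rightarrow> real) \<Rightarrow> nat \<Rightarrow> real Matrix.vec \<Rightarrow> real Matrix.vec \<Rightarrow> bool" where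
  "has_gradient g n a v \<longleftrightarrow>
     a \<in> carrier_vec n \<and> v \<in> carrier_vec n \<and>
     (\<forall>e>0. \<exists>d>0. \<forall>x\<in>carrier_vec n. euclid_norm (x - a) < d \<longrightarrow>
        \<bar>g x - g a - v \<bullet> (x - a)\<bar> \<le> e * euclid_norm (x - a))"

definition gradient ::
  "(real Matrix.vec \<Rightarrow> real) \<Rightarrow> nat \<Rightarrow> real Matrix.vec \<Rightarrow> real Matrix.vec" where
  "gradient g n a = (THE v. has_gradient g n a v)"

text \<open>
  An \<open>m \<times> n\<close> matrix \<open>A\<close> has here \<open>m\<close> singular values (with multiplicity), the square
  roots of the eigenvalues of \<open>A A\<^sup>T\<close>. For \<open>m \<le> n\<close> this is the usual list of
  \<open>min m n\<close> singular values. For \<open>m > n\<close> it contains in addition the value \<open>0\<close>, so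
  that the least singular value is always the minimum of \<open>\<parallel>A\<^sup>T u\<parallel>\<close> over unit vectors \<open>u\<close>,
  which is what backpropagation of gradients through \<open>A\<close> requires.
\<close>

definition singular_values :: "real mat \<Rightarrow> real set" where
  "singular_values A = {sqrt e | e. eigenvalue (A * transpose_mat A) e}"

definition sigma_min :: "real mat \<Rightarrow> real" where
  "sigma_min A = Min (singular_values A)"

definition sigma_max :: "real mat \<Rightarrow> real" where
  "sigma_max A = Max (singular_values A)"


section \<open>Layered models and token probabilities\<close>

text \<open>\<open>layers f l k\<close> is the composition \<open>f k \<circ> \<dots> \<circ> f (l + 1)\<close>, the identity if \<open>k \<le> l\<close>.\<close>

definition layers ::
  "(nat \<Rightarrow> real Matrix.vec \<Rightarrow> real Matrix.vec) \<Rightarrow> nat \<Rightarrow> nat \<Rightarrow> real Matrix.vec \<Rightarrow> real Matrix.vec" where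
  "layers f l k x = fold f [Suc l..<Suc k] x"

text \<open>
  The vocabulary of size \<open>N\<close> is identified with the set of indices \<open>{..<N}\<close>, where
  \<open>N\<close> is the dimension of the logit vector.
\<close>

definition softmax :: "real Matrix.vec \<Rightarrow> nat \<Rightarrow> real" where
  "softmax z k = exp (vec_index z k) / (\<Sum>m<dim_vec z. exp (vec_index z m))"


section \<open>The single-token GRPO objective\<close>

definition clip :: "real \<Rightarrow> real \<Rightarrow> real \<Rightarrow> real" where
  "clip x a b = min (max x a) b"

text \<open>Below, \<open>p\<close> is the probability of the token under the current policy.\<close>

definition grpo_objective ::
  "real \<Rightarrow> real \<Rightarrow> real \<Rightarrow> real \<Rightarrow> real \<Rightarrow> real \<Rightarrow> real \<Rightarrow> real" where
  "grpo_objective p_old p_ref adv eps_l eps_h \<beta> p =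
     min (p / p_old * adv) (clip (p / p_old) (1 - eps_l) (1 + eps_h) * adv)
     - \<beta> * (p_ref / p - ln (p_ref / p) - 1)"

definition trust_indicator :: "real \<Rightarrow> real \<Rightarrow> real \<Rightarrow> real \<Rightarrow> real" where
  "trust_indicator adv eps_l eps_h r =
     (if (adv > 0 \<and> r > 1 + eps_h) \<or> (adv < 0 \<and> r < 1 - eps_l) then 0 else 1)"

definition grpo_weight ::
  "real \<Rightarrow> real \<Rightarrow> real \<Rightarrow> real \<Rightarrow> real \<Rightarrow> real \<Rightarrow> real \<Rightarrow> real" where
  "grpo_weight p_old p_ref adv eps_l eps_h \<beta> p =
     p / p_old * adv * trust_indicator adv eps_l eps_h (p / p_old) + \<beta> * (p_ref / p) - \<beta>"

definition grpo_kink :: "real \<Rightarrow> real \<Rightarrow> real \<Rightarrow> real \<Rightarrow> bool" where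
  "grpo_kink adv eps_l eps_h r \<longleftrightarrow>
     (r = 1 + eps_h \<and> adv > 0) \<or> (r = 1 - eps_l \<and> adv < 0)"

text \<open>
  Gradient at \<open>a\<close> of the objective, where \<open>prob\<close> gives the token probability as a
  function of the activation in dimension \<open>n\<close>. Away from the kinks of the clipped term it
  is the actual gradient; at the kinks the convention is the weight times the gradient of
  the log-probability.
\<close>

definition grpo_gradient ::
  "real \<Rightarrow> real \<Rightarrow> real \<Rightarrow> real \<Rightarrow> real \<Rightarrow> real \<Rightarrow>
   (real Matrix.vec \<Rightarrow> real) \<Rightarrow> nat \<Rightarrow> real Matrix.vec \<Rightarrow> real Matrix.vec" where
  "grpo_gradient p_old p_ref adv eps_l eps_h \<beta> prob n a =
     (if grpo_kink adv eps_l eps_h (prob a / p_old)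
      then grpo_weight p_old p_ref adv eps_l eps_h \<beta> (prob a) \<cdot>\<^sub>v gradient (\<lambda>x. ln (prob x)) n a
      else gradient (\<lambda>x. grpo_objective p_old p_ref adv eps_l eps_h \<beta> (prob x)) n a)"

end

theory Submission
  imports Defs "Jordan_Normal_Form.Spectral_Radius" "HOL-Analysis.L2_Norm"
    "HOL-Analysis.Function_Topology"
begin

text \<open>
  Up to the factor \<open>w\<close>, the gradient of the objective is that of the log-probability. With respect
  to the logits the latter is \<open>e\<^sub>k - p\<close>, whose squared norm is
  \<open>(1 - p\<^sub>k)\<^sup>2 + (\<Sum>i\<noteq>k. p\<^sub>i\<^sup>2)\<close>. The entries of the remaining sum add up to \<open>1 - p\<^sub>k\<close>, so by
  Cauchy-Schwarz it lies between \<open>(1 - p\<^sub>k)\<^sup>2 / (N - 1)\<close> and \<open>(1 - p\<^sub>k)\<^sup>2\<close>. Each step of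
  backpropagation multiplies the gradient by the transposed Jacobian, which changes its norm by a
  factor between the extreme singular values: the quadratic form of \<open>A A\<^sup>T\<close> lies between its
  extreme eigenvalues, as one sees by minimizing it over the compact unit sphere.
\<close>

section \<open>Euclidean norm of vectors of explicit dimension\<close>

lemma euclid_norm_L2_set: "euclid_norm v = L2_set (($) v) {..<dim_vec v}"
  by (simp add: euclid_norm_def L2_set_def scalar_prod_def power2_eq_square atLeast0LessThan)

lemma euclid_norm_nonneg [simp]: "0 \<le> euclid_norm v"
  by (simp add: euclid_norm_L2_set)

lemma euclid_norm_square: "(euclid_norm v)\<^sup>2 = v \<bullet> v"
  by (simp add: euclid_norm_L2_set L2_set_def scalar_prod_def power2_eq_square atLeast0LessThan sum_nonneg)

lemma euclid_norm_eq_0_iff: "v \<in> carrier_vec n \<Longrightarrow> euclid_norm v = 0 \<longleftrightarrow> v = 0\<^sub>v n"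
  by (auto simp: euclid_norm_L2_set L2_set_eq_0_iff intro!: eq_vecI)

lemma euclid_norm_smult: "euclid_norm (k \<cdot>\<^sub>v v) = \<bar>k\<bar> * euclid_norm v"
proof -
  have "(k \<cdot>\<^sub>v v) \<bullet> (k \<cdot>\<^sub>v v) = k\<^sup>2 * (v \<bullet> v)"
    by (simp add: scalar_prod_def sum_distrib_left power2_eq_square algebra_simps)
  then show ?thesis
    by (simp add: euclid_norm_def real_sqrt_mult)
qed

lemma euclid_norm_add_le:
  assumes "u \<in> carrier_vec n" "v \<in> carrier_vec n"
  shows "euclid_norm (u + v) \<le> euclid_norm u + euclid_norm v"
proof -
  have "L2_set (($) (u + v)) {..<n} = L2_set (\<lambda>i. u $ i + v $ i) {..<n}"
    using assms by (intro L2_set_cong) auto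
  then show ?thesis
    using L2_set_triangle_ineq[of "($) u" "($) v" "{..<n}"] assms
    by (simp add: euclid_norm_L2_set)
qed

lemma abs_scalar_prod_le:
  assumes "u \<in> carrier_vec n" "v \<in> carrier_vec n"
  shows "\<bar>u \<bullet> v\<bar> \<le> euclid_norm u * euclid_norm v"
proof -
  have "\<bar>u \<bullet> v\<bar> \<le> (\<Sum>i<n. \<bar>u $ i\<bar> * \<bar>v $ i\<bar>)"
    using assms by (auto simp: scalar_prod_def atLeast0LessThan abs_mult[symmetric] intro: sum_abs)
  also have "\<dots> \<le> euclid_norm u * euclid_norm v"
    using L2_set_mult_ineq[of "($) u" "($) v" "{..<n}"] assms by (simp add: euclid_norm_L2_set)
  finally show ?thesis .
qed

text \<open>Cauchy-Schwarz on each row bounds the image by the sum of the row norms. The constant is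
  crude, but it only has to absorb the linear part of the inner function in the chain rule.\<close>

lemma mult_mat_vec_bounded:
  assumes A: "A \<in> carrier_mat m n"
  obtains C where "C \<ge> 0" "\<And>h. h \<in> carrier_vec n \<Longrightarrow> euclid_norm (A *\<^sub>v h) \<le> C * euclid_norm h"
proof
  let ?C = "\<Sum>i<m. euclid_norm (Matrix.row A i)"
  show "?C \<ge> 0" by (simp add: sum_nonneg)
  fix h :: "real Matrix.vec" assume h: "h \<in> carrier_vec n"
  have "euclid_norm (A *\<^sub>v h) \<le> (\<Sum>i<m. \<bar>Matrix.row A i \<bullet> h\<bar>)"
    using A L2_set_le_sum_abs[of "($) (A *\<^sub>v h)" "{..<m}"] by (simp add: euclid_norm_L2_set)
  also have "\<dots> \<le> (\<Sum>i<m. euclid_norm (Matrix.row A i) * euclid_norm h)"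
    using A h by (intro sum_mono abs_scalar_prod_le) auto
  also have "\<dots> = ?C * euclid_norm h"
    by (simp add: sum_distrib_right)
  finally show "euclid_norm (A *\<^sub>v h) \<le> ?C * euclid_norm h" .
qed

section \<open>Extreme eigenvalues of symmetric matrices\<close>

lemma quadratic_form_sum:
  assumes "B \<in> carrier_mat n n" "v \<in> carrier_vec n"
  shows "v \<bullet> (B *\<^sub>v v) = (\<Sum>i<n. \<Sum>j<n. v $ i * B $$ (i, j) * v $ j)"
  using assms
  by (auto simp: scalar_prod_def atLeast0LessThan sum_distrib_left mult.assoc intro!: sum.cong)

text \<open>Compactness of the unit sphere. Vectors of dimension \<open>n\<close> are encoded as
  functions \<open>nat \<Rightarrow> real\<close> that vanish from \<open>n\<close> on, because
  these carry the product topology, in which continuous functions attain their infimum on compact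
  sets.\<close>

lemma quadratic_form_attains_min:
  fixes B :: "real mat"
  assumes B: "B \<in> carrier_mat n n" and n: "n > 0"
  obtains x where "x \<in> carrier_vec n" "x \<bullet> x = 1"
    "\<And>y. y \<in> carrier_vec n \<Longrightarrow> y \<bullet> y = 1 \<Longrightarrow> x \<bullet> (B *\<^sub>v x) \<le> y \<bullet> (B *\<^sub>v y)"
proof -
  \<comment> \<open>A unit vector has all its coordinates between -1 and 1, so the sphere lies in
    this box. With the remaining coordinates pinned to 0, \<open>K\<close> is a product of compact
    sets and Tychonoff's theorem applies.\<close>
  define K where "K = PiE UNIV (\<lambda>i. if i < n then {-1..1} else {0::real})"
  define S where "S = K \<inter> {x. (\<Sum>i<n. x i * x i) = 1}"
  define q where "q x = (\<Sum>i<n. \<Sum>j<n. x i * B $$ (i, j) * x j)" for x :: "nat \<Rightarrow> real"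
  define g where "g y = (\<lambda>i. if i < n then y $ i else 0)" for y :: "real Matrix.vec"
  have gS: "g y \<in> S" and qg: "q (g y) = y \<bullet> (B *\<^sub>v y)"
    if y: "y \<in> carrier_vec n" "y \<bullet> y = 1" for y
  proof -
    have sum1: "(\<Sum>i<n. y $ i * y $ i) = 1"
      using y by (simp add: scalar_prod_def atLeast0LessThan)
    have "\<bar>y $ i\<bar> \<le> 1" if "i < n" for i
    proof -
      have "y $ i * y $ i \<le> (\<Sum>i<n. y $ i * y $ i)"
        using that by (intro member_le_sum) auto
      then show ?thesis
        using sum1 by (simp add: abs_square_le_1[symmetric] power2_eq_square)
    qed
    then show "g y \<in> S"
      using sum1 by (auto simp: g_def S_def K_def abs_le_iff minus_le_iff)
    show "q (g y) = y \<bullet> (B *\<^sub>v y)"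
      using y by (simp add: g_def q_def quadratic_form_sum[OF B])
  qed
  have "compactin (product_topology (\<lambda>i. euclidean) UNIV) K"
    unfolding K_def compactin_PiE by auto
  then have "compact K"
    by (simp add: euclidean_product_topology)
  moreover have "closed {x :: nat \<Rightarrow> real. (\<Sum>i<n. x i * x i) = 1}"
    by (intro closed_Collect_eq continuous_intros) auto
  ultimately have "compact S"
    by (simp add: S_def compact_Int_closed)
  moreover have "S \<noteq> {}"
    using gS[of "unit_vec n 0"] n by auto
  moreover have "continuous_on S q"
    unfolding q_def by (intro continuous_intros continuous_on_subset[OF continuous_on_product_coordinates]) auto
  ultimately obtain z where z: "z \<in> S" "\<And>y. y \<in> S \<Longrightarrow> q z \<le> q y"
    using continuous_attains_inf by metis
  define x where "x = vec n z"
  \<comment> \<open>The minimizer vanishes from \<open>n\<close> on, hence \<open>g\<close> recovers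
    it from its first \<open>n\<close> coordinates.\<close>
  have "z i \<in> (if i < n then {-1..1} else {0})" for i
    using z(1) by (auto simp: S_def K_def PiE_iff)
  then have "z i = 0" if "\<not> i < n" for i
    using that by (metis singletonD)
  then have "g x = z"
    by (auto simp: g_def x_def)
  moreover have x: "x \<in> carrier_vec n" "x \<bullet> x = 1"
    using z(1) by (auto simp: x_def S_def scalar_prod_def atLeast0LessThan)
  ultimately have "q z = x \<bullet> (B *\<^sub>v x)"
    using qg by metis
  then show thesis
    using that[OF x] z(2) gS qg by metis
qed

text \<open>The value \<open>k\<close> is the minimum of the form on the unit sphere. Homogeneity
  extends the bound to all vectors, and a minimizer turns out to be an eigenvector.\<close>

lemma symmetric_least_eigenvalue:
  fixes B :: "real mat"
  assumes B: "B \<in> carrier_mat n n" and sym: "transpose_mat B = B" and n: "n > 0"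
  obtains k where "eigenvalue B k" "\<And>y. y \<in> carrier_vec n \<Longrightarrow> k * (y \<bullet> y) \<le> y \<bullet> (B *\<^sub>v y)"
proof -
  obtain x where x: "x \<in> carrier_vec n" "x \<bullet> x = 1"
    and x_min: "\<And>y. y \<in> carrier_vec n \<Longrightarrow> y \<bullet> y = 1 \<Longrightarrow> x \<bullet> (B *\<^sub>v x) \<le> y \<bullet> (B *\<^sub>v y)"
    using quadratic_form_attains_min[OF B n] by metis
  define k where "k = x \<bullet> (B *\<^sub>v x)"
  have quad: "k * (y \<bullet> y) \<le> y \<bullet> (B *\<^sub>v y)" if y: "y \<in> carrier_vec n" for y
  proof (cases "y = 0\<^sub>v n")
    case True
    then show ?thesis using B by auto
  next
    case False
    define r where "r = euclid_norm y"
    have r: "r > 0" and r2: "y \<bullet> y = r * r"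
      using False euclid_norm_eq_0_iff[OF y] euclid_norm_nonneg[of y] euclid_norm_square[of y]
      by (auto simp: r_def power2_eq_square less_le)
    let ?u = "(1 / r) \<cdot>\<^sub>v y"
    have u: "?u \<bullet> ?u = 1"
      using y r r2 by simp
    have "?u \<bullet> (B *\<^sub>v ?u) = (y \<bullet> (B *\<^sub>v y)) / (r * r)"
      using y B by (simp add: mult_mat_vec)
    then have "k \<le> (y \<bullet> (B *\<^sub>v y)) / (r * r)"
      using x_min[OF _ u] y by (simp only: k_def smult_carrier_vec)
    then show ?thesis
      using r r2 by (simp add: field_simps)
  qed
  define y where "y = B *\<^sub>v x - k \<cdot>\<^sub>v x"
  have y: "y \<in> carrier_vec n" and Bx: "B *\<^sub>v x \<in> carrier_vec n"
    using B x by (auto simp: y_def)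
  define b where "b = y \<bullet> (B *\<^sub>v y) - k * (y \<bullet> y)"
  have comm: "x \<bullet> (B *\<^sub>v y) = y \<bullet> (B *\<^sub>v x)"
    using transpose_vec_mult_scalar[OF B y x(1)] comm_scalar_prod[OF Bx y] by (simp add: sym)
  \<comment> \<open>The form of \<open>B - k I\<close> is nonnegative and vanishes at \<open>x\<close>, so its first variation in
    the direction \<open>y = (B - k I) x\<close>, which is \<open>2 (y \<bullet> y)\<close>, must vanish.\<close>
  have yy: "y \<bullet> (B *\<^sub>v x) - k * (y \<bullet> x) = y \<bullet> y"
    using scalar_prod_minus_distrib[OF y Bx, of "k \<cdot>\<^sub>v x"] y x by (simp add: y_def[symmetric])
  have "0 \<le> t * (2 * (y \<bullet> y) + t * b)" for t
  proof -
    let ?z = "x + t \<cdot>\<^sub>v y"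
    have By: "B *\<^sub>v y \<in> carrier_vec n" using B y by auto
    have "B *\<^sub>v ?z = B *\<^sub>v x + t \<cdot>\<^sub>v (B *\<^sub>v y)"
      using B x y by (simp add: mult_add_distrib_mat_vec[OF B] mult_mat_vec[OF B])
    then have 1: "?z \<bullet> (B *\<^sub>v ?z) = k + 2 * t * (y \<bullet> (B *\<^sub>v x)) + t * t * (y \<bullet> (B *\<^sub>v y))"
      using x y By Bx comm
      by (simp add: add_scalar_prod_distrib[of _ n] scalar_prod_add_distrib[of _ n] k_def algebra_simps)
    have 2: "?z \<bullet> ?z = 1 + 2 * t * (y \<bullet> x) + t * t * (y \<bullet> y)"
      using x y comm_scalar_prod[OF x(1) y]
      by (simp add: add_scalar_prod_distrib[of _ n] scalar_prod_add_distrib[of _ n] algebra_simps)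
    have "k * (?z \<bullet> ?z) \<le> ?z \<bullet> (B *\<^sub>v ?z)"
      using quad[of ?z] x y by simp
    then have "0 \<le> 2 * t * (y \<bullet> (B *\<^sub>v x) - k * (y \<bullet> x)) + t * t * b"
      unfolding 1 2 b_def by (simp add: algebra_simps)
    then show ?thesis
      unfolding yy by (simp add: algebra_simps)
  qed
  have "y \<bullet> y = 0"
  proof (rule ccontr)
    assume "y \<bullet> y \<noteq> 0"
    then have p: "y \<bullet> y > 0"
      using euclid_norm_square[of y] by (metis less_le zero_le_power2)
    \<comment> \<open>A negative \<open>t\<close> makes the outer factor negative, and dividing by
      \<open>1 + \<bar>b\<bar>\<close> keeps \<open>t * b\<close> too small to cancel
      \<open>2 * (y \<bullet> y)\<close>. The product is then negative, against the inequality just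
      shown.\<close>
    define t where "t = - (y \<bullet> y) / (1 + \<bar>b\<bar>)"
    have "\<bar>t * b\<bar> \<le> y \<bullet> y"
      using p by (simp add: t_def abs_mult field_simps)
    then have "2 * (y \<bullet> y) + t * b > 0" using p by linarith
    moreover have "t < 0" using p by (simp add: t_def field_simps)
    ultimately show False
      using \<open>0 \<le> t * (2 * (y \<bullet> y) + t * b)\<close> by (simp add: zero_le_mult_iff)
  qed
  then have "y = 0\<^sub>v n"
    using euclid_norm_eq_0_iff[OF y] by (simp add: euclid_norm_def)
  then have "B *\<^sub>v x = k \<cdot>\<^sub>v x"
    using B x by (auto simp: y_def vec_eq_iff)
  moreover have "x \<noteq> 0\<^sub>v n" using x by auto
  ultimately have "eigenvalue B k"
    using B x unfolding eigenvalue_def eigenvector_def by auto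
  then show thesis using quad that by blast
qed

text \<open>Passing to \<open>- B\<close> negates the form and the eigenvalues, so the least
  eigenvalue there gives the greatest one here.\<close>

lemma symmetric_greatest_eigenvalue:
  fixes B :: "real mat"
  assumes B: "B \<in> carrier_mat n n" and sym: "transpose_mat B = B" and n: "n > 0"
  obtains k where "eigenvalue B k" "\<And>y. y \<in> carrier_vec n \<Longrightarrow> y \<bullet> (B *\<^sub>v y) \<le> k * (y \<bullet> y)"
proof -
  have neg: "- B *\<^sub>v y = - (B *\<^sub>v y)" if "y \<in> carrier_vec n" for y
    using B that by (auto simp: uminus_scalar_prod[symmetric] intro!: eq_vecI)
  obtain k where k: "eigenvalue (- B) k"
    "\<And>y. y \<in> carrier_vec n \<Longrightarrow> k * (y \<bullet> y) \<le> y \<bullet> (- B *\<^sub>v y)"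
    using symmetric_least_eigenvalue[of "- B" n] B n sym by (auto simp: transpose_uminus)
  then obtain x where x: "x \<in> carrier_vec n" "x \<noteq> 0\<^sub>v n" "- (B *\<^sub>v x) = k \<cdot>\<^sub>v x"
    using B neg by (auto simp: eigenvalue_def eigenvector_def)
  have "B *\<^sub>v x = (- k) \<cdot>\<^sub>v x"
  proof (rule eq_vecI)
    fix i assume "i < dim_vec ((- k) \<cdot>\<^sub>v x)"
    then have "(- (B *\<^sub>v x)) $ i = (k \<cdot>\<^sub>v x) $ i" "i < n" using x by auto
    then show "(B *\<^sub>v x) $ i = ((- k) \<cdot>\<^sub>v x) $ i" using B x(1) by auto
  qed (use B x in auto)
  then have "eigenvalue B (- k)"
    using B x unfolding eigenvalue_def eigenvector_def by auto
  moreover have "y \<bullet> (B *\<^sub>v y) \<le> - k * (y \<bullet> y)" if "y \<in> carrier_vec n" for y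
    using k(2)[OF that] that B by (simp add: neg)
  ultimately show thesis using that by blast
qed

section \<open>Singular values bound the action of the transpose\<close>

lemma finite_singular_values:
  assumes "A \<in> carrier_mat m n"
  shows "finite (singular_values A)"
proof -
  have "singular_values A = sqrt ` spectrum (A * transpose_mat A)"
    by (auto simp: singular_values_def spectrum_def)
  then show ?thesis
    using assms by (simp add: card_finite_spectrum[of _ m])
qed

text \<open>The squared norm of \<open>transpose_mat A *\<^sub>v u\<close> is the quadratic form of
  \<open>A A\<^sup>T\<close> at \<open>u\<close>, and the square roots of the eigenvalues of
  \<open>A A\<^sup>T\<close> are the singular values of \<open>A\<close>.\<close>

lemma sigma_transpose_bounds:
  assumes A: "A \<in> carrier_mat m n" and u: "u \<in> carrier_vec m"
  shows "sigma_min A * euclid_norm u \<le> euclid_norm (transpose_mat A *\<^sub>v u)"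
    and "euclid_norm (transpose_mat A *\<^sub>v u) \<le> sigma_max A * euclid_norm u"
proof -
  let ?B = "A * transpose_mat A"
  have B: "?B \<in> carrier_mat m m" and sym: "transpose_mat ?B = ?B"
    using A by (auto simp: transpose_mult[of _ m n])
  have Atu: "transpose_mat A *\<^sub>v u \<in> carrier_vec n" using A u by auto
  have uBu: "u \<bullet> (?B *\<^sub>v u) = (transpose_mat A *\<^sub>v u) \<bullet> (transpose_mat A *\<^sub>v u)"
    using transpose_vec_mult_scalar[OF A Atu u] A u by (simp add: assoc_mult_mat_vec[of _ m n _ m])
  \<comment> \<open>Finiteness of the set of singular values is what makes \<open>Min\<close> and
    \<open>Max\<close> actual bounds for its members.\<close>
  have sv: "sigma_min A \<le> sqrt k \<and> sqrt k \<le> sigma_max A" if "eigenvalue ?B k" for k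
    using that finite_singular_values[OF A]
    by (auto simp: sigma_min_def sigma_max_def singular_values_def intro!: Min_le Max_ge)
  consider "m = 0" | "m > 0" by blast
  then have "sigma_min A * euclid_norm u \<le> euclid_norm (transpose_mat A *\<^sub>v u)
    \<and> euclid_norm (transpose_mat A *\<^sub>v u) \<le> sigma_max A * euclid_norm u"
  proof cases
    \<comment> \<open>A matrix of size 0 has no eigenvalues, so \<open>sigma_min\<close> and
      \<open>sigma_max\<close> refer to the empty set and carry no information. Both norms are 0
      here, which settles the claim.\<close>
    case 1
    then have "u \<bullet> u = 0" "u \<bullet> (?B *\<^sub>v u) = 0"
      using u A by (simp_all add: scalar_prod_def)
    then show ?thesis by (simp add: euclid_norm_def uBu[symmetric])
  next
    case 2
    obtain k where k: "eigenvalue ?B k" "k * (u \<bullet> u) \<le> u \<bullet> (?B *\<^sub>v u)"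
      using symmetric_least_eigenvalue[OF B sym 2] u by metis
    \<comment> \<open>The real \<open>sqrt\<close> is odd and multiplicative on all reals, so it
      splits over \<open>k * (u \<bullet> u)\<close> whatever the sign of \<open>k\<close>.\<close>
    have "sqrt k * euclid_norm u \<le> euclid_norm (transpose_mat A *\<^sub>v u)"
      using k(2) unfolding uBu euclid_norm_def by (metis real_sqrt_le_mono real_sqrt_mult)
    then have lo: "sigma_min A * euclid_norm u \<le> euclid_norm (transpose_mat A *\<^sub>v u)"
      using sv[OF k(1)] by (meson euclid_norm_nonneg mult_right_mono order_trans)
    obtain k' where k': "eigenvalue ?B k'" "u \<bullet> (?B *\<^sub>v u) \<le> k' * (u \<bullet> u)"
      using symmetric_greatest_eigenvalue[OF B sym 2] u by metis
    have "euclid_norm (transpose_mat A *\<^sub>v u) \<le> sqrt k' * euclid_norm u"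
      using k'(2) unfolding uBu euclid_norm_def by (metis real_sqrt_le_mono real_sqrt_mult)
    then have "euclid_norm (transpose_mat A *\<^sub>v u) \<le> sigma_max A * euclid_norm u"
      using sv[OF k'(1)] by (meson euclid_norm_nonneg mult_right_mono order_trans)
    with lo show ?thesis by blast
  qed
  then show "sigma_min A * euclid_norm u \<le> euclid_norm (transpose_mat A *\<^sub>v u)"
    "euclid_norm (transpose_mat A *\<^sub>v u) \<le> sigma_max A * euclid_norm u" by auto
qed

section \<open>Gradients and Jacobians: uniqueness and chain rules\<close>

lemma add_minus_cancel_vec:
  fixes a h :: "real Matrix.vec"
  shows "a \<in> carrier_vec n \<Longrightarrow> h \<in> carrier_vec n \<Longrightarrow> a + h - a = h"
  by auto

lemma add_diff_vec:
  fixes u w :: "real Matrix.vec"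
  shows "u \<in> carrier_vec n \<Longrightarrow> w \<in> carrier_vec n \<Longrightarrow> u = w + (u - w)"
  by auto

lemma has_gradientD:
  assumes "has_gradient g n a v" "e > 0"
  obtains d where "d > 0"
    "\<And>x. x \<in> carrier_vec n \<Longrightarrow> euclid_norm (x - a) < d \<Longrightarrow>
       \<bar>g x - g a - v \<bullet> (x - a)\<bar> \<le> e * euclid_norm (x - a)"
  using assms by (auto simp: has_gradient_def)

lemma has_jacobianD:
  assumes "has_jacobian f n m a J" "e > 0"
  obtains d where "d > 0"
    "\<And>x. x \<in> carrier_vec n \<Longrightarrow> euclid_norm (x - a) < d \<Longrightarrow>
       euclid_norm (f x - f a - J *\<^sub>v (x - a)) \<le> e * euclid_norm (x - a)"
  using assms unfolding has_jacobian_def by blast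

text \<open>Both linear approximations are compared at a single point, displaced from
  \<open>a\<close> in the direction \<open>v - v'\<close> in which they differ most.\<close>

lemma has_gradient_unique:
  assumes v: "has_gradient g n a v" and v': "has_gradient g n a v'"
  shows "v = v'"
proof (rule ccontr)
  assume neq: "v \<noteq> v'"
  have car: "a \<in> carrier_vec n" "v \<in> carrier_vec n" "v' \<in> carrier_vec n"
    using v v' by (auto simp: has_gradient_def)
  define w where "w = v - v'"
  define W where "W = euclid_norm w"
  have w: "w \<in> carrier_vec n" using car by (simp add: w_def)
  have "w \<noteq> 0\<^sub>v n"
    using neq car by (auto simp: w_def vec_eq_iff)
  then have W: "W > 0"
    using euclid_norm_eq_0_iff[OF w] euclid_norm_nonneg[of w] by (auto simp: W_def less_le)
  obtain d where d: "d > 0" "\<And>x. x \<in> carrier_vec n \<Longrightarrow> euclid_norm (x - a) < d \<Longrightarrow>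
       \<bar>g x - g a - v \<bullet> (x - a)\<bar> \<le> W / 4 * euclid_norm (x - a)"
    using has_gradientD[OF v, of "W / 4"] W by auto
  obtain d' where d': "d' > 0" "\<And>x. x \<in> carrier_vec n \<Longrightarrow> euclid_norm (x - a) < d' \<Longrightarrow>
       \<bar>g x - g a - v' \<bullet> (x - a)\<bar> \<le> W / 4 * euclid_norm (x - a)"
    using has_gradientD[OF v', of "W / 4"] W by auto
  \<comment> \<open>The displacement \<open>t \<cdot>\<^sub>v w\<close> has length
    \<open>min d d' / 2\<close>, inside both radii. Two errors of at most
    \<open>W / 4 * (t * W)\<close> allow the linear parts to differ by
    \<open>t * (W * W) / 2\<close>, yet they differ by \<open>t * (W * W)\<close>.\<close>
  define t where "t = min d d' / (2 * W)"
  have t: "t > 0" using d d' W by (simp add: t_def)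
  let ?h = "t \<cdot>\<^sub>v w"
  have h: "?h \<in> carrier_vec n" "euclid_norm ?h = t * W"
    using w t by (auto simp: euclid_norm_smult W_def)
  have "t * W < d" "t * W < d'"
    using d d' W by (auto simp: t_def min_def)
  then have "\<bar>g (a + ?h) - g a - v \<bullet> ?h\<bar> \<le> W / 4 * (t * W)"
    "\<bar>g (a + ?h) - g a - v' \<bullet> ?h\<bar> \<le> W / 4 * (t * W)"
    using d(2)[of "a + ?h"] d'(2)[of "a + ?h"] h car by (simp_all add: add_minus_cancel_vec[of _ n])
  moreover have "v \<bullet> ?h - v' \<bullet> ?h = t * (W * W)"
    using car w minus_scalar_prod_distrib[of v n v' w] euclid_norm_square[of w]
    by (simp add: w_def[symmetric] W_def power2_eq_square right_diff_distrib[symmetric])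
  ultimately have "t * (W * W) \<le> t * (W * W) / 2"
    by argo
  moreover have "t * (W * W) > 0" using t W by simp
  ultimately show False by linarith
qed

lemma gradient_eqI: "has_gradient g n a v \<Longrightarrow> gradient g n a = v"
  unfolding gradient_def using has_gradient_unique by blast

text \<open>Reduces uniqueness of the Jacobian to uniqueness of gradients, row by row: a component
  of the remainder is at most its norm.\<close>

lemma has_gradient_component:
  assumes J: "has_jacobian f n m a J" and fa: "f a \<in> carrier_vec m" and i: "i < m"
  shows "has_gradient (\<lambda>x. f x $ i) n a (Matrix.row J i)"
proof -
  have Jc: "J \<in> carrier_mat m n" and a: "a \<in> carrier_vec n"
    using J by (auto simp: has_jacobian_def)
  have "\<exists>d>0. \<forall>x\<in>carrier_vec n. euclid_norm (x - a) < d \<longrightarrow>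
      \<bar>f x $ i - f a $ i - Matrix.row J i \<bullet> (x - a)\<bar> \<le> e * euclid_norm (x - a)" if e: "e > 0" for e
  proof -
    obtain d where d: "d > 0" "\<And>x. x \<in> carrier_vec n \<Longrightarrow> euclid_norm (x - a) < d \<Longrightarrow>
       euclid_norm (f x - f a - J *\<^sub>v (x - a)) \<le> e * euclid_norm (x - a)"
      using has_jacobianD[OF J e] by metis
    have "\<bar>f x $ i - f a $ i - Matrix.row J i \<bullet> (x - a)\<bar> \<le> euclid_norm (f x - f a - J *\<^sub>v (x - a))" for x
    proof -
      let ?r = "f x - f a - J *\<^sub>v (x - a)"
      \<comment> \<open>A difference of vectors takes its dimension from the subtrahend, so
        \<open>?r\<close> has dimension \<open>m\<close> because of \<open>J\<close>, for every
        \<open>x\<close>.\<close>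
      have "\<bar>?r $ i\<bar> \<le> L2_set (\<lambda>i. \<bar>?r $ i\<bar>) {..<m}"
        using i by (intro member_le_L2_set) auto
      also have "\<dots> = euclid_norm ?r"
        using Jc by (simp add: euclid_norm_L2_set L2_set_def)
      finally show ?thesis using fa i Jc by simp
    qed
    then show ?thesis using d order_trans by blast
  qed
  then show ?thesis using Jc a i by (auto simp: has_gradient_def)
qed

lemma jacobian_eqI:
  assumes J: "has_jacobian f n m a J" and fa: "f a \<in> carrier_vec m"
  shows "jacobian f n m a = J"
  unfolding jacobian_def
proof (rule the_equality[where P = "has_jacobian f n m a", OF J])
  fix J' assume J': "has_jacobian f n m a J'"
  have "J \<in> carrier_mat m n" "J' \<in> carrier_mat m n"
    using J J' by (auto simp: has_jacobian_def)
  then show "J' = J"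
    using has_gradient_unique[OF has_gradient_component[OF J' fa] has_gradient_component[OF J fa]]
    by (intro eq_rowI) auto
qed

lemma has_gradient_cong:
  assumes "\<And>x. x \<in> carrier_vec n \<Longrightarrow> g x = g' x" "has_gradient g n a v"
  shows "has_gradient g' n a v"
  using assms by (auto simp: has_gradient_def)

lemma has_gradient_coordinate:
  assumes "a \<in> carrier_vec n" "i < n"
  shows "has_gradient (\<lambda>x. x $ i) n a (unit_vec n i)"
  using assms by (auto simp: has_gradient_def scalar_prod_left_unit intro!: exI[of _ 1])

lemma has_gradient_const: "a \<in> carrier_vec n \<Longrightarrow> has_gradient (\<lambda>x. k) n a (0\<^sub>v n)"
  by (auto simp: has_gradient_def intro!: exI[of _ 1])

lemma has_gradient_add:
  assumes g: "has_gradient g n a u" and h: "has_gradient h n a v"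
  shows "has_gradient (\<lambda>x. g x + h x) n a (u + v)"
proof -
  have car: "a \<in> carrier_vec n" "u \<in> carrier_vec n" "v \<in> carrier_vec n"
    using g h by (auto simp: has_gradient_def)
  have "\<exists>d>0. \<forall>x\<in>carrier_vec n. euclid_norm (x - a) < d \<longrightarrow>
      \<bar>g x + h x - (g a + h a) - (u + v) \<bullet> (x - a)\<bar> \<le> e * euclid_norm (x - a)" if e: "e > 0" for e
  proof -
    obtain d where d: "d > 0" "\<And>x. x \<in> carrier_vec n \<Longrightarrow> euclid_norm (x - a) < d \<Longrightarrow>
       \<bar>g x - g a - u \<bullet> (x - a)\<bar> \<le> e / 2 * euclid_norm (x - a)"
      using has_gradientD[OF g, of "e / 2"] e by auto
    obtain d' where d': "d' > 0" "\<And>x. x \<in> carrier_vec n \<Longrightarrow> euclid_norm (x - a) < d' \<Longrightarrow>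
       \<bar>h x - h a - v \<bullet> (x - a)\<bar> \<le> e / 2 * euclid_norm (x - a)"
      using has_gradientD[OF h, of "e / 2"] e by auto
    have "\<bar>g x + h x - (g a + h a) - (u + v) \<bullet> (x - a)\<bar> \<le> e * euclid_norm (x - a)"
      if x: "x \<in> carrier_vec n" "euclid_norm (x - a) < min d d'" for x
    proof -
      have "(u + v) \<bullet> (x - a) = u \<bullet> (x - a) + v \<bullet> (x - a)"
        using car x by (intro add_scalar_prod_distrib) auto
      moreover have "\<bar>g x - g a - u \<bullet> (x - a)\<bar> \<le> e / 2 * euclid_norm (x - a)"
        "\<bar>h x - h a - v \<bullet> (x - a)\<bar> \<le> e / 2 * euclid_norm (x - a)"
        using d(2) d'(2) x by auto
      ultimately show ?thesis by argo
    qed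
    then show ?thesis using d(1) d'(1) by (intro exI[of _ "min d d'"]) auto
  qed
  then show ?thesis using car by (auto simp: has_gradient_def)
qed

text \<open>The sum of the gradients is written componentwise, since the zero vector to start from
  depends on \<open>n\<close>.\<close>

lemma has_gradient_sum:
  assumes "finite I" "a \<in> carrier_vec n" "\<And>i. i \<in> I \<Longrightarrow> has_gradient (g i) n a (v i)"
  shows "has_gradient (\<lambda>x. \<Sum>i\<in>I. g i x) n a (vec n (\<lambda>j. \<Sum>i\<in>I. v i $ j))"
  using assms
proof (induction I rule: finite_induct)
  case empty
  have "vec n (\<lambda>j. 0) = (0\<^sub>v n :: real Matrix.vec)" by auto
  then show ?case using empty by (simp add: has_gradient_const)
next
  case (insert i I)
  have "v i \<in> carrier_vec n"
    using insert.prems(2)[of i] by (simp add: has_gradient_def)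
  then have "vec n (\<lambda>j. \<Sum>i\<in>insert i I. v i $ j) = v i + vec n (\<lambda>j. \<Sum>i\<in>I. v i $ j)"
    using insert.hyps by auto
  then show ?case
    using has_gradient_add[OF insert.prems(2)[of i] insert.IH] insert by simp
qed

text \<open>Caratheodory's form writes the increment as \<open>\<psi> z * (z - y)\<close> with
  \<open>\<psi>\<close> continuous at \<open>y\<close>, which gives the estimate at
  \<open>z = y\<close> along with all other points.\<close>

lemma DERIV_linear_approximation:
  fixes \<phi> :: "real \<Rightarrow> real"
  assumes "DERIV \<phi> y :> D" "e > 0"
  obtains d where "d > 0" "\<And>z. \<bar>z - y\<bar> < d \<Longrightarrow> \<bar>\<phi> z - \<phi> y - D * (z - y)\<bar> \<le> e * \<bar>z - y\<bar>"
proof -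
  obtain \<psi> where \<psi>: "\<And>z. \<phi> z - \<phi> y = \<psi> z * (z - y)" "isCont \<psi> y" "\<psi> y = D"
    using assms(1) unfolding CARAT_DERIV by blast
  obtain d where d0: "d > 0" "\<And>z. z \<noteq> y \<Longrightarrow> \<bar>z - y\<bar> < d \<Longrightarrow> \<bar>\<psi> z - D\<bar> < e"
    using \<psi>(2,3) assms(2) unfolding isCont_def LIM_def dist_real_def by metis
  then have d: "d > 0" "\<And>z. \<bar>z - y\<bar> < d \<Longrightarrow> \<bar>\<psi> z - D\<bar> < e"
    using \<psi>(3) assms(2) by (metis abs_zero diff_self)+
  have "\<bar>\<phi> z - \<phi> y - D * (z - y)\<bar> \<le> e * \<bar>z - y\<bar>" if "\<bar>z - y\<bar> < d" for z
  proof -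
    have "\<phi> z - \<phi> y - D * (z - y) = (\<psi> z - D) * (z - y)"
      by (simp add: \<psi>(1) algebra_simps)
    then show ?thesis
      using d(2)[OF that] by (simp add: abs_mult mult_right_mono)
  qed
  then show thesis using that d(1) by blast
qed

text \<open>The error splits into that of \<open>\<phi>\<close> at \<open>g x\<close> and
  \<open>D\<close> times that of \<open>g\<close>; each is kept below half of the allowed
  amount.\<close>

lemma has_gradient_compose_real:
  assumes g: "has_gradient g n a v" and \<phi>: "DERIV \<phi> (g a) :> D"
  shows "has_gradient (\<lambda>x. \<phi> (g x)) n a (D \<cdot>\<^sub>v v)"
proof -
  have car: "a \<in> carrier_vec n" "v \<in> carrier_vec n"
    using g by (auto simp: has_gradient_def)
  \<comment> \<open>A local growth constant of \<open>g\<close>: the gradient contributes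
    \<open>euclid_norm v\<close>, the remainder at most 1 because \<open>e2 \<le> 1\<close>. The
    radius \<open>d1 / V\<close> below therefore keeps \<open>g x\<close> within \<open>d1\<close>
    of \<open>g a\<close>.\<close>
  define V where "V = euclid_norm v + 1"
  have V: "V \<ge> 1" by (simp add: V_def)
  have half: "s * (r / (2 * s)) = r / 2" if "s > 0" for r s :: real
    using that by simp
  have "\<exists>d>0. \<forall>x\<in>carrier_vec n. euclid_norm (x - a) < d \<longrightarrow>
      \<bar>\<phi> (g x) - \<phi> (g a) - (D \<cdot>\<^sub>v v) \<bullet> (x - a)\<bar> \<le> e * euclid_norm (x - a)" if e: "e > 0" for e
  proof -
    obtain d1 where d1: "d1 > 0"
      "\<And>z. \<bar>z - g a\<bar> < d1 \<Longrightarrow> \<bar>\<phi> z - \<phi> (g a) - D * (z - g a)\<bar> \<le> e / (2 * V) * \<bar>z - g a\<bar>"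
      using DERIV_linear_approximation[OF \<phi>, of "e / (2 * V)"] e V by auto
    \<comment> \<open>The bound 1 serves the growth estimate, the other one gives
      \<open>\<bar>D\<bar> * e2 \<le> e / 2\<close>; adding 1 to \<open>\<bar>D\<bar>\<close> avoids
      division by 0.\<close>
    define e2 where "e2 = min 1 (e / (2 * (\<bar>D\<bar> + 1)))"
    have e2: "e2 > 0" "e2 \<le> 1" using e by (auto simp: e2_def)
    have "\<bar>D\<bar> * e2 \<le> (\<bar>D\<bar> + 1) * (e / (2 * (\<bar>D\<bar> + 1)))"
      using e2 by (intro mult_mono) (auto simp: e2_def)
    also have "\<dots> = e / 2" using half[of "\<bar>D\<bar> + 1" e] by simp
    finally have De2: "\<bar>D\<bar> * e2 \<le> e / 2" .
    obtain d2 where d2: "d2 > 0" "\<And>x. x \<in> carrier_vec n \<Longrightarrow> euclid_norm (x - a) < d2 \<Longrightarrow>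
       \<bar>g x - g a - v \<bullet> (x - a)\<bar> \<le> e2 * euclid_norm (x - a)"
      using has_gradientD[OF g e2(1)] by metis
    have "\<bar>\<phi> (g x) - \<phi> (g a) - (D \<cdot>\<^sub>v v) \<bullet> (x - a)\<bar> \<le> e * euclid_norm (x - a)"
      if x: "x \<in> carrier_vec n" "euclid_norm (x - a) < min d2 (d1 / V)" for x
    proof -
      let ?h = "x - a"
      have h: "?h \<in> carrier_vec n" using x car by auto
      have gx: "\<bar>g x - g a - v \<bullet> ?h\<bar> \<le> e2 * euclid_norm ?h"
        using d2 x by auto
      also have "\<dots> \<le> 1 * euclid_norm ?h"
        using e2 by (intro mult_right_mono) auto
      finally have "\<bar>g x - g a\<bar> \<le> V * euclid_norm ?h"
        using abs_scalar_prod_le[OF car(2) h] by (simp add: V_def algebra_simps abs_le_iff)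
      moreover have "V * euclid_norm ?h < d1"
        using x V by (simp add: field_simps)
      ultimately have "\<bar>\<phi> (g x) - \<phi> (g a) - D * (g x - g a)\<bar> \<le> e / (2 * V) * (V * euclid_norm ?h)"
        using d1(2)[of "g x"] e V
        by (smt (verit, best) divide_nonneg_pos mult_left_mono)
      then have 1: "\<bar>\<phi> (g x) - \<phi> (g a) - D * (g x - g a)\<bar> \<le> e / 2 * euclid_norm ?h"
        using V by simp
      have "\<bar>D * (g x - g a - v \<bullet> ?h)\<bar> \<le> \<bar>D\<bar> * (e2 * euclid_norm ?h)"
        unfolding abs_mult by (intro mult_left_mono gx) auto
      also have "\<dots> \<le> e / 2 * euclid_norm ?h"
        using mult_right_mono[OF De2, of "euclid_norm ?h"] by (simp add: mult.assoc)
      finally have 2: "\<bar>D * (g x - g a - v \<bullet> ?h)\<bar> \<le> e / 2 * euclid_norm ?h" .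
      have "\<phi> (g x) - \<phi> (g a) - (D \<cdot>\<^sub>v v) \<bullet> ?h =
          (\<phi> (g x) - \<phi> (g a) - D * (g x - g a)) + D * (g x - g a - v \<bullet> ?h)"
        using car h by (simp add: algebra_simps)
      moreover have "e * euclid_norm ?h = e / 2 * euclid_norm ?h + e / 2 * euclid_norm ?h"
        by simp
      ultimately show ?thesis using 1 2 by linarith
    qed
    then show ?thesis using d1(1) d2(1) V by (intro exI[of _ "min d2 (d1 / V)"]) auto
  qed
  then show ?thesis using car by (auto simp: has_gradient_def)
qed

text \<open>One step of backpropagation: the adjoint identity moves the Jacobian from the
  displacement to the gradient. The error is that of \<open>g\<close> at \<open>f x\<close> plus the
  product of \<open>v\<close> with the remainder of \<open>f\<close>.\<close>

lemma has_gradient_compose: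
  assumes J: "has_jacobian f n m a J" and f: "f \<in> carrier_vec n \<rightarrow> carrier_vec m"
    and g: "has_gradient g m (f a) v"
  shows "has_gradient (\<lambda>x. g (f x)) n a (transpose_mat J *\<^sub>v v)"
proof -
  have car: "a \<in> carrier_vec n" "v \<in> carrier_vec m" and Jc: "J \<in> carrier_mat m n"
    using g J by (auto simp: has_gradient_def has_jacobian_def)
  obtain C where C: "C \<ge> 0" "\<And>h. h \<in> carrier_vec n \<Longrightarrow> euclid_norm (J *\<^sub>v h) \<le> C * euclid_norm h"
    using mult_mat_vec_bounded[OF Jc] by metis
  define V where "V = euclid_norm v"
  have V: "V \<ge> 0" by (simp add: V_def)
  have half: "s * (r / (2 * s)) = r / 2" if "s > 0" for r s :: real
    using that by simp
  have "\<exists>d>0. \<forall>x\<in>carrier_vec n. euclid_norm (x - a) < d \<longrightarrow>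
      \<bar>g (f x) - g (f a) - (transpose_mat J *\<^sub>v v) \<bullet> (x - a)\<bar> \<le> e * euclid_norm (x - a)"
    if e: "e > 0" for e
  proof -
    \<comment> \<open>\<open>C + 1\<close> is the local growth constant of \<open>f\<close>:
      \<open>C\<close> comes from the linear part and 1 from the remainder.\<close>
    obtain d1 where d1: "d1 > 0" "\<And>y. y \<in> carrier_vec m \<Longrightarrow> euclid_norm (y - f a) < d1 \<Longrightarrow>
       \<bar>g y - g (f a) - v \<bullet> (y - f a)\<bar> \<le> e / (2 * (C + 1)) * euclid_norm (y - f a)"
      using has_gradientD[OF g, of "e / (2 * (C + 1))"] e C(1) by auto
    define e2 where "e2 = min 1 (e / (2 * (V + 1)))"
    have e2: "e2 > 0" "e2 \<le> 1" using e V by (auto simp: e2_def)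
    have "V * e2 \<le> (V + 1) * (e / (2 * (V + 1)))"
      using e2 V by (intro mult_mono) (auto simp: e2_def)
    also have "\<dots> = e / 2" using half[of "V + 1" e] V by simp
    finally have Ve2: "V * e2 \<le> e / 2" .
    obtain d2 where d2: "d2 > 0" "\<And>x. x \<in> carrier_vec n \<Longrightarrow> euclid_norm (x - a) < d2 \<Longrightarrow>
       euclid_norm (f x - f a - J *\<^sub>v (x - a)) \<le> e2 * euclid_norm (x - a)"
      using has_jacobianD[OF J e2(1)] by metis
    have "\<bar>g (f x) - g (f a) - (transpose_mat J *\<^sub>v v) \<bullet> (x - a)\<bar> \<le> e * euclid_norm (x - a)"
      if x: "x \<in> carrier_vec n" "euclid_norm (x - a) < min d2 (d1 / (C + 1))" for x
    proof -
      let ?h = "x - a" and ?k = "f x - f a"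
      let ?r = "?k - J *\<^sub>v ?h"
      have fx: "f x \<in> carrier_vec m" "f a \<in> carrier_vec m" using f x car by auto
      have h: "?h \<in> carrier_vec n" and k: "?k \<in> carrier_vec m" and Jh: "J *\<^sub>v ?h \<in> carrier_vec m"
        and r: "?r \<in> carrier_vec m"
        using x car Jc fx by auto
      have r_le: "euclid_norm ?r \<le> e2 * euclid_norm ?h"
        using d2 x by auto
      also have "\<dots> \<le> 1 * euclid_norm ?h"
        using e2 by (intro mult_right_mono) auto
      finally have r_le1: "euclid_norm ?r \<le> euclid_norm ?h" by simp
      have "?k = J *\<^sub>v ?h + ?r" by (rule add_diff_vec[OF k Jh])
      then have "euclid_norm ?k \<le> euclid_norm (J *\<^sub>v ?h) + euclid_norm ?r"
        using euclid_norm_add_le[OF Jh r] by simp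
      also have "\<dots> \<le> (C + 1) * euclid_norm ?h"
        using C(2)[OF h] r_le1 by (simp add: algebra_simps)
      finally have k_le: "euclid_norm ?k \<le> (C + 1) * euclid_norm ?h" .
      also have "\<dots> < d1"
        using x C(1) by (simp add: field_simps)
      finally have "\<bar>g (f x) - g (f a) - v \<bullet> ?k\<bar> \<le> e / (2 * (C + 1)) * euclid_norm ?k"
        using d1(2)[OF fx(1)] by simp
      also have "\<dots> \<le> e / (2 * (C + 1)) * ((C + 1) * euclid_norm ?h)"
        using e C(1) by (intro mult_left_mono k_le) auto
      also have "\<dots> = (C + 1) * (e / (2 * (C + 1))) * euclid_norm ?h"
        by (simp only: mult_ac)
      also have "(C + 1) * (e / (2 * (C + 1))) = e / 2"
        using half[of "C + 1" e] C(1) by simp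
      finally have 1: "\<bar>g (f x) - g (f a) - v \<bullet> ?k\<bar> \<le> e / 2 * euclid_norm ?h" .
      have "\<bar>v \<bullet> ?r\<bar> \<le> V * (e2 * euclid_norm ?h)"
        using abs_scalar_prod_le[OF car(2) r] mult_left_mono[OF r_le V] by (simp add: V_def)
      also have "\<dots> \<le> e / 2 * euclid_norm ?h"
        using mult_right_mono[OF Ve2, of "euclid_norm ?h"] by (simp add: mult.assoc)
      finally have 2: "\<bar>v \<bullet> ?r\<bar> \<le> e / 2 * euclid_norm ?h" .
      have "v \<bullet> ?r = v \<bullet> ?k - (transpose_mat J *\<^sub>v v) \<bullet> ?h"
        using scalar_prod_minus_distrib[OF car(2) k Jh] transpose_vec_mult_scalar[OF Jc h car(2)] by simp
      moreover have "e * euclid_norm ?h = e / 2 * euclid_norm ?h + e / 2 * euclid_norm ?h"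
        by simp
      ultimately show ?thesis using 1 2 by linarith
    qed
    then show ?thesis using d1(1) d2(1) C(1) by (intro exI[of _ "min d2 (d1 / (C + 1))"]) auto
  qed
  then show ?thesis using car Jc by (auto simp: has_gradient_def)
qed

section \<open>Log-probability of a token as a function of the logits\<close>

lemma softmax_pos: "0 < dim_vec z \<Longrightarrow> 0 < softmax z k"
  unfolding softmax_def by (intro divide_pos_pos sum_pos) auto

lemma sum_softmax:
  assumes "0 < dim_vec z"
  shows "(\<Sum>k<dim_vec z. softmax z k) = 1"
proof -
  have "(\<Sum>m<dim_vec z. exp (z $ m)) > 0"
    using assms by (intro sum_pos) auto
  then show ?thesis
    by (simp add: softmax_def sum_divide_distrib[symmetric])
qed

text \<open>The log-probability is the coordinate \<open>z $ k\<close> minus the log-sum-exp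
  function, whose gradient is the softmax vector.\<close>

lemma has_gradient_ln_softmax:
  assumes a: "a \<in> carrier_vec N" and k: "k < N"
  shows "has_gradient (\<lambda>z. ln (softmax z k)) N a (unit_vec N k - vec N (softmax a))"
proof -
  define s where "s z = (\<Sum>m<N. exp (z $ m))" for z :: "real Matrix.vec"
  have s_pos: "s z > 0" for z
    using k unfolding s_def by (intro sum_pos) auto
  have coord: "has_gradient (\<lambda>z. exp (z $ m)) N a (exp (a $ m) \<cdot>\<^sub>v unit_vec N m)" if "m < N" for m
    using has_gradient_compose_real[OF has_gradient_coordinate[OF a that] DERIV_exp] .
  have "has_gradient s N a (vec N (\<lambda>j. \<Sum>m<N. (exp (a $ m) \<cdot>\<^sub>v unit_vec N m) $ j))"
    unfolding s_def[abs_def] using has_gradient_sum[of "{..<N}"] a coord by simp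
  also have "vec N (\<lambda>j. \<Sum>m<N. (exp (a $ m) \<cdot>\<^sub>v unit_vec N m) $ j) = vec N (\<lambda>j. exp (a $ j))"
    by (auto simp: unit_vec_def if_distrib cong: if_cong)
  finally have "has_gradient (\<lambda>z. - ln (s z)) N a (- inverse (s a) \<cdot>\<^sub>v vec N (\<lambda>j. exp (a $ j)))"
    by (rule has_gradient_compose_real)
      (auto intro!: derivative_eq_intros simp: s_pos divide_inverse)
  also have "- inverse (s a) \<cdot>\<^sub>v vec N (\<lambda>j. exp (a $ j)) = - vec N (softmax a)"
    using a by (auto simp: softmax_def s_def divide_inverse)
  finally have "has_gradient (\<lambda>z. z $ k + - ln (s z)) N a (unit_vec N k + - vec N (softmax a))"
    by (intro has_gradient_add has_gradient_coordinate a k)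
  then have "has_gradient (\<lambda>z. z $ k + - ln (s z)) N a (unit_vec N k - vec N (softmax a))"
    by (simp add: minus_add_uminus_vec[of _ N])
  then show ?thesis
  proof (rule has_gradient_cong[rotated])
    fix z :: "real Matrix.vec" assume "z \<in> carrier_vec N"
    then show "z $ k + - ln (s z) = ln (softmax z k)"
      using s_pos[of z] by (simp add: softmax_def s_def[symmetric] ln_div)
  qed
qed

lemma euclid_norm_ln_softmax_gradient:
  assumes a: "a \<in> carrier_vec N" and k: "k < N" and N: "N \<ge> 2"
  defines "v \<equiv> unit_vec N k - vec N (softmax a)"
  shows "sqrt (real N / (real N - 1)) * (1 - softmax a k) \<le> euclid_norm v"
    and "euclid_norm v \<le> sqrt 2 * (1 - softmax a k)"
proof -
  let ?I = "{..<N} - {k}" and ?p = "softmax a"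
  \<comment> \<open>The coordinate of \<open>v\<close> at \<open>k\<close> is \<open>q\<close>,
    which is also the sum of the other probabilities; \<open>Q\<close> is the sum of their
    squares.\<close>
  define Q where "Q = (L2_set ?p ?I)\<^sup>2"
  define q where "q = 1 - ?p k"
  have p: "?p i > 0" for i using a N by (simp add: softmax_pos)
  have rest: "sum ?p ?I = q"
    using sum_softmax[of a] a k by (simp add: q_def sum_diff1)
  have q: "q \<ge> 0" using p unfolding rest[symmetric] by (intro sum_nonneg) (auto intro: less_imp_le)
  have "(euclid_norm v)\<^sup>2 = (\<Sum>i<N. (v $ i)\<^sup>2)"
    by (simp add: euclid_norm_L2_set L2_set_def sum_nonneg v_def)
  also have "\<dots> = (v $ k)\<^sup>2 + (\<Sum>i\<in>?I. (v $ i)\<^sup>2)"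
    using k by (simp add: sum.remove[of _ k])
  also have "(\<Sum>i\<in>?I. (v $ i)\<^sup>2) = Q"
    unfolding Q_def L2_set_def using k by (auto simp: v_def sum_nonneg intro!: sum.cong)
  also have "v $ k = q" using k by (simp add: v_def q_def)
  finally have v2: "(euclid_norm v)\<^sup>2 = q\<^sup>2 + Q" .
  have "L2_set ?p ?I \<le> q"
    unfolding rest[symmetric] using p by (intro L2_set_le_sum) (auto intro: less_imp_le)
  then have "Q \<le> q\<^sup>2" unfolding Q_def by (intro power_mono) auto
  then have "(euclid_norm v)\<^sup>2 \<le> (sqrt 2 * q)\<^sup>2"
    by (simp add: v2 power_mult_distrib)
  moreover have "0 \<le> sqrt 2 * q" using q by simp
  ultimately show "euclid_norm v \<le> sqrt 2 * (1 - ?p k)"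
    unfolding q_def[symmetric] by (rule power2_le_imp_le)
  \<comment> \<open>Cauchy-Schwarz against the constant 1 on the \<open>N - 1\<close> indices other
    than \<open>k\<close>.\<close>
  have "q \<le> L2_set ?p ?I * L2_set (\<lambda>_. 1) ?I"
    using L2_set_mult_ineq[of ?p "\<lambda>_. 1" ?I] p by (simp add: rest[symmetric] less_imp_le)
  also have "L2_set (\<lambda>_. 1) ?I = sqrt (real N - 1)"
    using k by (simp add: L2_set_constant of_nat_diff)
  finally have "q\<^sup>2 \<le> (L2_set ?p ?I * sqrt (real N - 1))\<^sup>2"
    using q by (intro power_mono)
  then have "q\<^sup>2 \<le> Q * (real N - 1)"
    using N by (simp add: power_mult_distrib Q_def)
  \<comment> \<open>Uses \<open>q\<^sup>2 + q\<^sup>2 / (N - 1) = N / (N - 1) * q\<^sup>2\<close>,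
    where the first summand is the coordinate at \<open>k\<close>.\<close>
  then have "(sqrt (real N / (real N - 1)) * q)\<^sup>2 \<le> (euclid_norm v)\<^sup>2"
    using N by (simp add: v2 power_mult_distrib field_simps)
  then show "sqrt (real N / (real N - 1)) * (1 - ?p k) \<le> euclid_norm v"
    unfolding q_def[symmetric] by (rule power2_le_imp_le) simp
qed

section \<open>Derivative of the objective in the token probability\<close>

text \<open>Away from the kinks the term agrees near \<open>p\<close> with a linear or a constant
  function. The sign of \<open>A\<close> decides which clipping bound can be active: the upper one
  for positive \<open>A\<close>, the lower one for negative \<open>A\<close>.\<close>

lemma DERIV_clipped_term:
  assumes po: "p_old > 0" and eps: "eps_l > 0" "eps_h > 0"
    and nk: "\<not> grpo_kink A eps_l eps_h (p / p_old)"
  shows "DERIV (\<lambda>q. min (q / p_old * A) (clip (q / p_old) (1 - eps_l) (1 + eps_h) * A)) p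
           :> A / p_old * trust_indicator A eps_l eps_h (p / p_old)"
proof -
  let ?F = "\<lambda>q. min (q / p_old * A) (clip (q / p_old) (1 - eps_l) (1 + eps_h) * A)"
  \<comment> \<open>A derivative depends only on the values in an open set around the point, here a
    half-line.\<close>
  have local: "DERIV ?F p :> D" if "open U" "p \<in> U" "\<And>q. q \<in> U \<Longrightarrow> ?F q = g q" "DERIV g p :> D" for U g D
    using that DERIV_cong_ev[OF refl _ refl, of ?F g p D] eventually_nhds by blast
  have lin: "DERIV (\<lambda>q. q / p_old * A) p :> A / p_old"
    using po by (auto intro!: derivative_eq_intros)
  consider "A = 0" | "A > 0" "p / p_old < 1 + eps_h" | "A > 0" "p / p_old > 1 + eps_h"
    | "A < 0" "p / p_old > 1 - eps_l" | "A < 0" "p / p_old < 1 - eps_l"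
    using nk unfolding grpo_kink_def by argo
  then show ?thesis
  proof cases
    case 1
    then show ?thesis by simp
  next
    case 2
    have "DERIV ?F p :> A / p_old"
    proof (rule local[of "{..< p_old * (1 + eps_h)}"])
      show "?F q = q / p_old * A" if "q \<in> {..< p_old * (1 + eps_h)}" for q
      proof -
        have "q / p_old < 1 + eps_h" using that po by (simp add: field_simps)
        \<comment> \<open>Below the upper bound clipping can only raise the ratio, and with
          \<open>A > 0\<close> the minimum then selects the unclipped product.\<close>
        then have "q / p_old \<le> clip (q / p_old) (1 - eps_l) (1 + eps_h)" by (simp add: clip_def)
        then show ?thesis using 2 by (simp add: min_absorb1 mult_right_mono del: times_divide_eq_left)
      qed
    qed (use 2 po lin in \<open>auto simp: field_simps\<close>)
    then show ?thesis using 2 by (simp add: trust_indicator_def)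
  next
    case 3
    have "DERIV ?F p :> 0"
    proof (rule local[of "{p_old * (1 + eps_h) <..}"])
      show "?F q = (1 + eps_h) * A" if "q \<in> {p_old * (1 + eps_h) <..}" for q
      proof -
        have "q / p_old > 1 + eps_h" using that po by (simp add: field_simps)
        moreover from this have "clip (q / p_old) (1 - eps_l) (1 + eps_h) = 1 + eps_h"
          using eps by (simp add: clip_def)
        ultimately show ?thesis using 3 by (simp add: min_absorb2 mult_right_mono del: times_divide_eq_left)
      qed
    qed (use 3 po in \<open>auto simp: field_simps\<close>)
    then show ?thesis using 3 by (simp add: trust_indicator_def)
  next
    case 4
    have "DERIV ?F p :> A / p_old"
    proof (rule local[of "{p_old * (1 - eps_l) <..}"])
      show "?F q = q / p_old * A" if "q \<in> {p_old * (1 - eps_l) <..}" for q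
      proof -
        have "q / p_old > 1 - eps_l" using that po by (simp add: field_simps)
        \<comment> \<open>Mirror image: above the lower bound clipping can only lower the ratio, and
          the negative factor reverses the order.\<close>
        then have "clip (q / p_old) (1 - eps_l) (1 + eps_h) \<le> q / p_old" by (simp add: clip_def)
        then show ?thesis using 4 by (simp add: min_absorb1 mult_right_mono_neg del: times_divide_eq_left)
      qed
    qed (use 4 po lin in \<open>auto simp: field_simps\<close>)
    then show ?thesis using 4 by (simp add: trust_indicator_def)
  next
    case 5
    have "DERIV ?F p :> 0"
    proof (rule local[of "{..< p_old * (1 - eps_l)}"])
      show "?F q = (1 - eps_l) * A" if "q \<in> {..< p_old * (1 - eps_l)}" for q
      proof -
        have "q / p_old < 1 - eps_l" using that po by (simp add: field_simps)
        moreover from this have "clip (q / p_old) (1 - eps_l) (1 + eps_h) = 1 - eps_l"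
          using eps by (simp add: clip_def)
        ultimately show ?thesis using 5 by (simp add: min_absorb2 mult_right_mono_neg del: times_divide_eq_left)
      qed
    qed (use 5 po in \<open>auto simp: field_simps\<close>)
    then show ?thesis using 5 by (simp add: trust_indicator_def)
  qed
qed

text \<open>The weight is the derivative with respect to \<open>ln p\<close>, hence the division by
  \<open>p\<close>. The penalty contributes \<open>\<beta> * (p_ref / p - 1)\<close> to it, the
  clipped term the rest.\<close>

lemma DERIV_grpo_objective:
  assumes po: "p_old > 0" and pr: "p_ref > 0" and eps: "eps_l > 0" "eps_h > 0" and p: "p > 0"
    and nk: "\<not> grpo_kink adv eps_l eps_h (p / p_old)"
  shows "DERIV (grpo_objective p_old p_ref adv eps_l eps_h \<beta>) p
           :> grpo_weight p_old p_ref adv eps_l eps_h \<beta> p / p"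
proof -
  have "DERIV (\<lambda>q. \<beta> * (p_ref / q - ln (p_ref / q) - 1)) p :> \<beta> * (- (p_ref / (p * p)) + 1 / p)"
    using p pr by (auto intro!: derivative_eq_intros simp: field_simps)
  from DERIV_diff[OF DERIV_clipped_term[OF po eps nk] this] show ?thesis
    unfolding grpo_objective_def[abs_def] grpo_weight_def
    by (rule DERIV_cong) (use p po in \<open>simp add: field_simps\<close>)
qed

text \<open>Unites the two branches of \<open>grpo_gradient\<close>: the formula is the convention
  at a kink and follows from the chain rule elsewhere.\<close>

lemma grpo_gradient_eq:
  assumes po: "p_old > 0" and pr: "p_ref > 0" and eps: "eps_l > 0" "eps_h > 0"
    and pos: "\<And>x. x \<in> carrier_vec n \<Longrightarrow> prob x > 0"
    and v: "has_gradient (\<lambda>x. ln (prob x)) n a v"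
  shows "grpo_gradient p_old p_ref adv eps_l eps_h \<beta> prob n a
           = grpo_weight p_old p_ref adv eps_l eps_h \<beta> (prob a) \<cdot>\<^sub>v v"
proof (cases "grpo_kink adv eps_l eps_h (prob a / p_old)")
  case True
  then show ?thesis by (simp add: grpo_gradient_def gradient_eqI[OF v])
next
  case False
  \<comment> \<open>Seen as a function of \<open>u = ln p\<close>, the objective has the weight as its derivative.\<close>
  let ?F = "grpo_objective p_old p_ref adv eps_l eps_h \<beta>"
    and ?w = "grpo_weight p_old p_ref adv eps_l eps_h \<beta> (prob a)"
  have pa: "prob a > 0" using v pos by (auto simp: has_gradient_def)
  have "DERIV (?F \<circ> exp) (ln (prob a)) :> ?w / prob a * exp (ln (prob a))"
    using DERIV_grpo_objective[OF po pr eps pa False] pa by (intro DERIV_chain DERIV_exp) simp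
  then have "DERIV (\<lambda>u. ?F (exp u)) (ln (prob a)) :> ?w"
    using pa by (simp add: o_def)
  from has_gradient_compose_real[OF v this]
  have "has_gradient (\<lambda>x. ?F (prob x)) n a (?w \<cdot>\<^sub>v v)"
    by (rule has_gradient_cong[rotated]) (simp add: pos)
  then show ?thesis using False by (simp add: grpo_gradient_def gradient_eqI)
qed

section \<open>Backpropagation through the layers\<close>

lemma layers_self [simp]: "layers f L L x = x"
  by (simp add: layers_def)

lemma layers_step: "l < L \<Longrightarrow> layers f l L x = layers f (Suc l) L (f (Suc l) x)"
  by (simp add: layers_def upt_conv_Cons del: upt_Suc)

text \<open>Shows that logits have the right dimension for every input, so that the token
  probability is positive on the whole space and not only at \<open>a l\<close>.\<close>

lemma layers_carrier:
  assumes "l \<le> L" "x \<in> carrier_vec (n l)"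
    and "\<And>l. l \<in> {1..L} \<Longrightarrow> f l \<in> carrier_vec (n (l - 1)) \<rightarrow> carrier_vec (n l)"
  shows "layers f l L x \<in> carrier_vec (n L)"
  using assms(1,2)
proof (induction l arbitrary: x rule: inc_induct)
  case (step l)
  then have "f (Suc l) x \<in> carrier_vec (n (Suc l))" using assms(3)[of "Suc l"] by auto
  then show ?case using step by (simp add: layers_step)
qed simp

lemma layers_activation:
  assumes "l \<le> L" "\<And>l. l \<in> {1..L} \<Longrightarrow> a l = f l (a (l - 1))"
  shows "layers f l L (a l) = a L"
  using assms(1)
proof (induction l rule: inc_induct)
  case (step l)
  then show ?case using assms(2)[of "Suc l"] by (simp add: layers_step)
qed simp

text \<open>Downward induction from \<open>l = L\<close>, where the composition is the identity and
  both products are empty. Each layer multiplies the gradient by its transposed Jacobian and so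
  contributes one factor \<open>c\<close> or \<open>d\<close>.\<close>

lemma backpropagation_bounds:
  assumes "l \<le> L"
    and dom: "\<And>l. l \<in> {1..L} \<Longrightarrow> f l \<in> carrier_vec (n (l - 1)) \<rightarrow> carrier_vec (n l)"
    and act: "\<And>l. l \<in> {1..L} \<Longrightarrow> a l = f l (a (l - 1))"
    and diff: "\<And>l. l \<in> {1..L} \<Longrightarrow> differentiable_vec_at (f l) (n (l - 1)) (n l) (a (l - 1))"
    and jac: "\<And>l. l \<in> {1..L} \<Longrightarrow> J l = jacobian (f l) (n (l - 1)) (n l) (a (l - 1))"
    and pos: "\<And>l. l \<in> {1..L} \<Longrightarrow> c l \<ge> 0 \<and> d l \<ge> 0"
    and sigma: "\<And>l. l \<in> {1..L} \<Longrightarrow> sigma_min (J l) \<ge> c l \<and> sigma_max (J l) \<le> d l"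
    and u: "has_gradient g (n L) (a L) u"
  shows "\<exists>v. has_gradient (\<lambda>x. g (layers f l L x)) (n l) (a l) v
           \<and> (\<Prod>j=l+1..L. c j) * euclid_norm u \<le> euclid_norm v
           \<and> euclid_norm v \<le> (\<Prod>j=l+1..L. d j) * euclid_norm u"
  using assms(1)
proof (induction l rule: inc_induct)
  case base
  then show ?case using u by auto
next
  case (step l)
  let ?m = "Suc l"
  have m: "?m \<in> {1..L}" using step by auto
  obtain v where v: "has_gradient (\<lambda>x. g (layers f ?m L x)) (n ?m) (a ?m) v"
    "(\<Prod>j=?m+1..L. c j) * euclid_norm u \<le> euclid_norm v"
    "euclid_norm v \<le> (\<Prod>j=?m+1..L. d j) * euclid_norm u"
    using step.IH by auto
  obtain K where K: "has_jacobian (f ?m) (n l) (n ?m) (a l) K"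
    using diff[OF m] by (auto simp: differentiable_vec_at_def)
  then have Kc: "K \<in> carrier_mat (n ?m) (n l)" and al: "a l \<in> carrier_vec (n l)"
    by (auto simp: has_jacobian_def)
  \<comment> \<open>\<open>jacobian\<close> is a definite description, so uniqueness is what carries
    the singular value bounds over to the witness \<open>K\<close>.\<close>
  have "J ?m = K"
    using jac[OF m] jacobian_eqI[OF K] dom[OF m] al by auto
  then have sK: "c ?m \<le> sigma_min K" "sigma_max K \<le> d ?m" using sigma[OF m] by auto
  have vc: "v \<in> carrier_vec (n ?m)" using v(1) by (simp add: has_gradient_def)
  let ?v = "transpose_mat K *\<^sub>v v"
  have "has_gradient (\<lambda>x. g (layers f ?m L (f ?m x))) (n l) (a l) ?v"
    using has_gradient_compose[OF K] dom[OF m] v(1) act[OF m] by simp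
  then have "has_gradient (\<lambda>x. g (layers f l L x)) (n l) (a l) ?v"
    using step by (simp add: layers_step)
  moreover have "c ?m * euclid_norm v \<le> euclid_norm ?v"
    using sigma_transpose_bounds(1)[OF Kc vc] sK(1) by (meson euclid_norm_nonneg mult_right_mono order_trans)
  \<comment> \<open>The induction hypothesis is multiplied by the nonnegative \<open>c ?m\<close>,
    which is the first factor of the longer product.\<close>
  then have "(\<Prod>j=l+1..L. c j) * euclid_norm u \<le> euclid_norm ?v"
    using mult_left_mono[OF v(2), of "c ?m"] pos[OF m] m
    by (simp add: prod.atLeast_Suc_atMost[of ?m] mult.assoc)
  moreover have "euclid_norm ?v \<le> d ?m * euclid_norm v"
    using sigma_transpose_bounds(2)[OF Kc vc] sK(2) by (meson euclid_norm_nonneg mult_right_mono order_trans)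
  then have "euclid_norm ?v \<le> (\<Prod>j=l+1..L. d j) * euclid_norm u"
    using mult_left_mono[OF v(3), of "d ?m"] pos[OF m] m
    by (simp add: prod.atLeast_Suc_atMost[of ?m] mult.assoc)
  ultimately show ?case by blast
qed

theorem proposition4p2:
  fixes L N :: nat
    and n :: "nat \<Rightarrow> nat"
    and f :: "nat \<Rightarrow> real Matrix.vec \<Rightarrow> real Matrix.vec"
    and a :: "nat \<Rightarrow> real Matrix.vec"
    and J :: "nat \<Rightarrow> real mat"
    and c d :: "nat \<Rightarrow> real"
    and tok :: nat
    and p_old p_ref adv eps_l eps_h \<beta> p w :: real
    and \<delta> :: "nat \<Rightarrow> real Matrix.vec"
  assumes "N \<ge> 2" and "n L = N"
    and "\<And>l. l \<in> {1..L} \<Longrightarrow> f l \<in> carrier_vec (n (l - 1)) \<rightarrow> carrier_vec (n l)"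
    and "a 0 \<in> carrier_vec (n 0)"
    and "\<And>l. l \<in> {1..L} \<Longrightarrow> a l = f l (a (l - 1))"
    and "\<And>l. l \<in> {1..L} \<Longrightarrow> differentiable_vec_at (f l) (n (l - 1)) (n l) (a (l - 1))"
    and "\<And>l. l \<in> {1..L} \<Longrightarrow> J l = jacobian (f l) (n (l - 1)) (n l) (a (l - 1))"
    and "\<And>l. l \<in> {1..L} \<Longrightarrow> c l > 0 \<and> d l > 0"
    and "\<And>l. l \<in> {1..L} \<Longrightarrow> sigma_min (J l) \<ge> c l \<and> sigma_max (J l) \<le> d l"
    and "0 < p_old" "p_old \<le> 1" and "0 < p_ref" "p_ref \<le> 1"
    and "eps_l > 0" and "eps_h > 0" and "\<beta> \<ge> 0"
    and "tok < N"
    and "p = softmax (a L) tok"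
    and "w = grpo_weight p_old p_ref adv eps_l eps_h \<beta> p"
    and "\<And>l. l \<in> {1..L} \<Longrightarrow>
           \<delta> l = grpo_gradient p_old p_ref adv eps_l eps_h \<beta>
                   (\<lambda>x. softmax (layers f l L x) tok) (n l) (a l)"
  shows "\<forall>l\<in>{1..L}.
           (\<Prod>j=l+1..L. c j) * \<bar>w\<bar> * sqrt (real N / (real N - 1)) * (1 - p)
             \<le> euclid_norm (\<delta> l)
         \<and> euclid_norm (\<delta> l)
             \<le> (\<Prod>j=l+1..L. d j) * \<bar>w\<bar> * sqrt 2 * (1 - p)"
proof
  fix l assume l: "l \<in> {1..L}"
  note dom = assms(3) and act = assms(5) and diff = assms(6) and jac = assms(7)
    and sigma = assms(9)
  have cd: "c j \<ge> 0 \<and> d j \<ge> 0" if "j \<in> {1..L}" for j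
    using assms(8)[OF that] by auto
  let ?w = "grpo_weight p_old p_ref adv eps_l eps_h \<beta> p"
    and ?u = "unit_vec N tok - vec N (softmax (a L))"
    and ?prob = "\<lambda>x. softmax (layers f l L x) tok"
  have lL: "l \<le> L" using l by simp
  \<comment> \<open>The dimension of the activation is read off from differentiability of the last
    layer, as \<open>has_jacobian\<close> includes it.\<close>
  have "a (L - 1) \<in> carrier_vec (n (L - 1))"
    using diff[of L] l by (auto simp: differentiable_vec_at_def has_jacobian_def)
  then have aL: "a L \<in> carrier_vec N"
    using dom[of L] act[of L] l \<open>n L = N\<close> by auto
  have "has_gradient (\<lambda>z. ln (softmax z tok)) (n L) (a L) ?u"
    using has_gradient_ln_softmax[OF aL \<open>tok < N\<close>] \<open>n L = N\<close> by simp
  from backpropagation_bounds[OF lL dom act diff jac cd sigma this]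
  obtain v where v: "has_gradient (\<lambda>x. ln (?prob x)) (n l) (a l) v"
    "(\<Prod>j=l+1..L. c j) * euclid_norm ?u \<le> euclid_norm v"
    "euclid_norm v \<le> (\<Prod>j=l+1..L. d j) * euclid_norm ?u"
    by auto
  have prob_pos: "?prob x > 0" if "x \<in> carrier_vec (n l)" for x
    using layers_carrier[OF lL that dom] \<open>n L = N\<close> \<open>tok < N\<close> by (intro softmax_pos) auto
  have "?prob (a l) = p"
    using layers_activation[of l L a f] lL act \<open>p = softmax (a L) tok\<close> by simp
  then have "\<delta> l = w \<cdot>\<^sub>v v"
    using assms(20)[OF l] grpo_gradient_eq[OF \<open>0 < p_old\<close> \<open>0 < p_ref\<close> \<open>eps_l > 0\<close> \<open>eps_h > 0\<close> prob_pos v(1)]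
      \<open>w = ?w\<close> by simp
  then have \<delta>: "euclid_norm (\<delta> l) = \<bar>w\<bar> * euclid_norm v"
    by (simp add: euclid_norm_smult)
  note bounds = euclid_norm_ln_softmax_gradient[OF aL \<open>tok < N\<close> \<open>N \<ge> 2\<close>, folded \<open>p = softmax (a L) tok\<close>]
  \<comment> \<open>Nonnegative products allow the softmax bounds on \<open>euclid_norm ?u\<close>
    to be inserted into both inequalities.\<close>
  have "(\<Prod>j=l+1..L. c j) \<ge> 0" "(\<Prod>j=l+1..L. d j) \<ge> 0"
    using cd l by (auto intro!: prod_nonneg)
  then have "(\<Prod>j=l+1..L. c j) * (sqrt (real N / (real N - 1)) * (1 - p)) \<le> euclid_norm v"
    "euclid_norm v \<le> (\<Prod>j=l+1..L. d j) * (sqrt 2 * (1 - p))"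
    using v(2,3) bounds by (meson mult_left_mono order_trans)+
  from this[THEN mult_left_mono, of "\<bar>w\<bar>"]
  show "(\<Prod>j=l+1..L. c j) * \<bar>w\<bar> * sqrt (real N / (real N - 1)) * (1 - p) \<le> euclid_norm (\<delta> l)
      \<and> euclid_norm (\<delta> l) \<le> (\<Prod>j=l+1..L. d j) * \<bar>w\<bar> * sqrt 2 * (1 - p)"
    by (simp add: \<delta> mult_ac)
qed

end
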